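(* Let $\mathcal{Y}=\{0,1\}$. Assume $D(r)=r^{-1}$. Let $f$ be a ranking function. Assume also $p=\Pr[Y=1]>0$ and $\overline{y}^f(s)=\Pr[Y=1\mid\tilde f(X)=s]$ is a continuous function. Then, as $n\to\infty$, $$\mathrm{NDCG}_D(f,S_n)\overset{p}{\to}\Pr[Y=1\mid\tilde f(X)=1],$$ where $\overset{p}{\to}$ denotes convergence in probability.
   Context: $P_{XY}$ is a probability distribution on $\mathcal{X}\times\mathcal{Y}$ and $(X,Y)\sim P_{XY}$; $(x_1,y_1),(x_2,y_2),\ldots$ are i.i.d. from $P_{XY}$ and $S_n=\{(x_1,y_1),\ldots,(x_n,y_n)\}$. A ranking function is a map $f:\mathcal{X}\to\mathbb{R}$. It orders $x_1,\ldots,x_n$ by score, giving $x^f_{(1)},\ldots,x^f_{(n)}$ with $f(x^f_{(1)})\ge\cdots\ge f(x^f_{(n)})$; $y^f_{(r)}$ denotes the label of $x^f_{(r)}$. For a discount function $D$, $\mathrm{DCG}_D(f,S_n)=\sum_{r=1}^n y^f_{(r)}D(r)$; $\mathrm{IDCG}_D(S_n)=\max_{f'}\sum_{r=1}^n y^{f'}_{(r)}D(r)$ is the DCG of the best ranking of $S_n$; $\mathrm{NDCG}_D(f,S_n)=\mathrm{DCG}_D(f,S_n)/\mathrm{IDCG}_D(S_n)$. The canonical version of $f$ is $\tilde f(x)=\Pr_{X\sim P_X}[f(X)\le f(x)]$, where $P_X$ is the marginal of $X$. The limit $\Pr[Y=1\mid\tilde f(X)=1]$ is the value $\overline{y}^f(1)$.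 *)

theory Defs
  imports "HOL-Probability.Probability" "HOL-Combinatorics.Permutations"
begin

text \<open>A sample \<open>S\<^sub>n\<close> is given by a function \<open>S\<close> whose values at the indices \<open>1, \<dots>, n\<close> are the
  labelled points. A ranking of the sample is a permutation \<open>\<sigma>\<close> of \<open>{1..n}\<close>, where \<open>\<sigma> r\<close> is the
  index of the point in position \<open>r\<close>. Ties between scores may be ordered in any way.\<close>

definition orders :: "nat \<Rightarrow> (nat \<Rightarrow> real) \<Rightarrow> (nat \<Rightarrow> nat) \<Rightarrow> bool" where
  "orders n v \<sigma> \<longleftrightarrow>
     \<sigma> permutes {1..n} \<and> (\<forall>r\<in>{1..n}. \<forall>s\<in>{1..n}. r \<le> s \<longrightarrow> v (\<sigma> s) \<le> v (\<sigma> r))"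

text \<open>A ranking function need not be injective, so the scores alone need not determine the
  ranking. An ordering rule chooses, measurably, one ranking for every vector of scores. It sees
  neither the labels nor the points themselves: a rule that did could make the ranking better or
  worse than the ranking function warrants. Wherever there are no ties, all rules agree.\<close>

definition ordering_rule :: "(nat \<Rightarrow> (nat \<Rightarrow> real) \<Rightarrow> nat \<Rightarrow> nat) \<Rightarrow> bool" where
  "ordering_rule \<rho> \<longleftrightarrow> (\<forall>n.
     \<rho> n \<in> (\<Pi>\<^sub>M i\<in>{1..n}. borel) \<rightarrow>\<^sub>M count_space {\<sigma>. \<sigma> permutes {1..n}} \<and>
     (\<forall>v\<in>space (\<Pi>\<^sub>M i\<in>{1..n}. borel). orders n v (\<rho> n v)))"

definition DCG_perm :: "(nat \<Rightarrow> real) \<Rightarrow> nat \<Rightarrow> (nat \<Rightarrow> 'x \<times> real) \<Rightarrow> (nat \<Rightarrow> nat) \<Rightarrow> real" where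
  "DCG_perm D n S \<sigma> = (\<Sum>r=1..n. snd (S (\<sigma> r)) * D r)"

definition DCG ::
  "(nat \<Rightarrow> (nat \<Rightarrow> real) \<Rightarrow> nat \<Rightarrow> nat) \<Rightarrow> (nat \<Rightarrow> real) \<Rightarrow> ('x \<Rightarrow> real) \<Rightarrow> nat \<Rightarrow> (nat \<Rightarrow> 'x \<times> real) \<Rightarrow> real"
where
  "DCG \<rho> D f n S = DCG_perm D n S (\<rho> n (\<lambda>i\<in>{1..n}. f (fst (S i))))"

text \<open>The maximum is over all ranking functions \<open>f'\<close> and all rankings compatible with \<open>f'\<close>, so
  that sample points with equal \<open>x\<close> but different labels may be placed in the best order.\<close>

definition IDCG :: "(nat \<Rightarrow> real) \<Rightarrow> nat \<Rightarrow> (nat \<Rightarrow> 'x \<times> real) \<Rightarrow> real" where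
  "IDCG D n S =
     Max {DCG_perm D n S \<sigma> | \<sigma>. \<exists>f' :: 'x \<Rightarrow> real. orders n (\<lambda>i. f' (fst (S i))) \<sigma>}"

text \<open>If all labels are \<open>0\<close>, this is \<open>0 / 0 = 0\<close>.\<close>

definition NDCG ::
  "(nat \<Rightarrow> (nat \<Rightarrow> real) \<Rightarrow> nat \<Rightarrow> nat) \<Rightarrow> (nat \<Rightarrow> real) \<Rightarrow> ('x \<Rightarrow> real) \<Rightarrow> nat \<Rightarrow> (nat \<Rightarrow> 'x \<times> real) \<Rightarrow> real"
where
  "NDCG \<rho> D f n S = DCG \<rho> D f n S / IDCG D n S"

definition canonical :: "'x measure \<Rightarrow> ('x \<Rightarrow> real) \<Rightarrow> 'x \<Rightarrow> real" where
  "canonical PX f x = measure PX {x' \<in> space PX. f x' \<le> f x}"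

text \<open>For a distribution \<open>P\<close> of \<open>(X, Y)\<close> and a statistic \<open>g\<close> of \<open>X\<close>, the function \<open>\<eta>\<close> is a version
  of \<open>s \<mapsto> Pr[Y = 1 | g X = s]\<close>: the conditional probability of \<open>Y = 1\<close> given the
  \<open>\<sigma>\<close>-algebra generated by \<open>g X\<close> is \<open>\<eta> (g X)\<close>.\<close>

definition cond_prob_label ::
  "('x \<times> real) measure \<Rightarrow> ('x \<Rightarrow> real) \<Rightarrow> (real \<Rightarrow> real) \<Rightarrow> bool" where
  "cond_prob_label P g \<eta> \<longleftrightarrow>
     (AE z in P. real_cond_exp P (vimage_algebra (space P) (\<lambda>z. g (fst z)) borel)
        (indicator {z \<in> space P. snd z = 1}) z = \<eta> (g (fst z)))"

definition converges_in_prob :: "'w measure \<Rightarrow> (nat \<Rightarrow> 'w \<Rightarrow> real) \<Rightarrow> real \<Rightarrow> bool" where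
  "converges_in_prob M W c \<longleftrightarrow>
     (\<forall>\<epsilon>>0. (\<lambda>n. measure M {\<omega> \<in> space M. \<bar>W n \<omega> - c\<bar> > \<epsilon>}) \<longlonglongrightarrow> 0)"

end

theory Submission
  imports Defs
begin

text \<open>Write \<open>H\<^sub>n\<close> for the harmonic numbers and \<open>F\<close> for the distribution function of \<open>f X\<close>, so that
  \<open>F (f X)\<close> is the canonical score. The harmonic weights diverge so slowly that \<open>H\<^sub>n - H\<^sub>m\<close> stays
  bounded as long as \<open>m\<close> is at least a fixed proportion of \<open>n\<close>. Hence the ideal DCG is
  \<open>H\<^sub>n + O(1)\<close>, since with high probability a fixed proportion of the labels is \<open>1\<close>.
  Likewise, for each \<open>\<delta> > 0\<close>, with high probability a fixed proportion of the canonical scores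
  exceeds \<open>1 - \<delta>\<close>; these points occupy the top positions, and by continuity replacing
  \<open>ybar (F (f x))\<close> by \<open>ybar 1\<close> in the DCG costs at most \<open>\<epsilon> H\<^sub>n + O(1)\<close>. Finally, the noise
  \<open>y - ybar (F (f x))\<close> is centred given all scores, and the ranking depends on the scores only, so
  the noise terms at different positions are orthogonal: the squared error they cause has
  expectation at most a constant times the sum of the \<open>1 / r\<^sup>2\<close>, which is negligible against
  \<open>H\<^sub>n\<^sup>2\<close>.\<close>

section \<open>Harmonic numbers\<close>

lemma harm_diff:
  assumes "m \<le> n"
  shows "harm n - harm m = (\<Sum>k\<in>{m<..n}. inverse (real k))"
proof -
  have "{1..n} = {1..m} \<union> {m<..n}" using assms by auto
  moreover have "sum (\<lambda>k. inverse (real k)) ({1..m} \<union> {m<..n})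
      = sum (\<lambda>k. inverse (real k)) {1..m} + sum (\<lambda>k. inverse (real k)) {m<..n}"
    by (rule sum.union_disjoint) auto
  ultimately show ?thesis by (simp add: harm_def)
qed

text \<open>The difference has at most \<open>n\<close> terms, each at most \<open>1 / m\<close>, so
  it is at most \<open>n / m\<close>. A logarithm would be sharper, but only a bound independent of
  \<open>n\<close> matters.\<close>

lemma harm_diff_le:
  assumes "m \<le> n" "0 < n" "0 < q" "q * real n \<le> real m"
  shows "harm n - harm m \<le> 1 / q"
proof -
  have m: "0 < real m"
    using assms(2-4) by (meson mult_pos_pos of_nat_0_less_iff order_less_le_trans)
  have "harm n - harm m = (\<Sum>k\<in>{m<..n}. inverse (real k))"
    using assms(1) by (rule harm_diff)
  also have "\<dots> \<le> (\<Sum>k\<in>{m<..n}. inverse (real m))"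
    using m by (intro sum_mono) (auto intro!: le_imp_inverse_le)
  also have "\<dots> \<le> real n / real m"
    using m assms(1) by (simp add: field_simps)
  also have "\<dots> \<le> 1 / q"
    using m assms by (simp add: field_simps)
  finally show ?thesis .
qed

section \<open>Deterministic bounds for rankings of a fixed sample\<close>

text \<open>Provides a ranking that puts a chosen set of points on top, by gluing a bijection onto
  \<open>A\<close> with one onto its complement.\<close>

lemma ex_permutes_initial_segment:
  assumes "A \<subseteq> {1..n}"
  obtains \<sigma> where "\<sigma> permutes {1..n}" "\<And>r. r \<in> {1..card A} \<Longrightarrow> \<sigma> r \<in> A"
proof -
  have fin: "finite A" using assms finite_subset by auto
  have K: "card A \<le> n" using card_mono[OF _ assms] by simp
  obtain h where h: "bij_betw h {1..card A} A"
    using ex_bij_betw_nat_finite_1[OF fin] by blast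
  have "card {card A<..n} = card ({1..n} - A)"
    using assms fin by (simp add: card_Diff_subset)
  then obtain h' where h': "bij_betw h' {card A<..n} ({1..n} - A)"
    by (meson bij_betw_iff_card finite_Diff finite_atLeastAtMost finite_greaterThanAtMost)
  define \<sigma> where "\<sigma> r = (if r \<in> {1..card A} then h r else if r \<in> {card A<..n} then h' r else r)" for r
  have \<sigma>A: "bij_betw \<sigma> {1..card A} A"
    by (rule bij_betw_cong[THEN iffD1, OF _ h]) (simp add: \<sigma>_def)
  have "bij_betw \<sigma> {card A<..n} ({1..n} - A)"
    by (rule bij_betw_cong[THEN iffD1, OF _ h']) (simp add: \<sigma>_def)
  with \<sigma>A have "bij_betw \<sigma> ({1..card A} \<union> {card A<..n}) (A \<union> ({1..n} - A))"
    by (rule bij_betw_combine) auto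
  moreover have "{1..card A} \<union> {card A<..n} = {1..n}" "A \<union> ({1..n} - A) = {1..n}"
    using assms K by auto
  ultimately have "bij_betw \<sigma> {1..n} {1..n}" by simp
  then have "\<sigma> permutes {1..n}"
    using K by (intro bij_imp_permutes) (auto simp: \<sigma>_def)
  moreover have "\<sigma> r \<in> A" if "r \<in> {1..card A}" for r
    using \<sigma>A that by (rule bij_betw_apply)
  ultimately show ?thesis by (rule that)
qed

text \<open>No label exceeds 1, which bounds every DCG from above. A ranking that starts with all
  points labelled 1 collects the first discounts in full, which gives the lower bound.\<close>

lemma IDCG_binary_bounds:
  fixes S :: "nat \<Rightarrow> 'x \<times> real"
  assumes bin: "\<And>i. i \<in> {1..n} \<Longrightarrow> snd (S i) \<in> {0, 1}"
  defines "I \<equiv> IDCG (\<lambda>r. inverse (real r)) n S"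
  shows "harm (card {i \<in> {1..n}. snd (S i) = 1}) \<le> I" "I \<le> harm n"
proof -
  let ?D = "\<lambda>r. inverse (real r)"
  let ?A = "{i \<in> {1..n}. snd (S i) = 1}"
  let ?R = "{DCG_perm ?D n S \<sigma> | \<sigma>. \<exists>f' :: 'x \<Rightarrow> real. orders n (\<lambda>i. f' (fst (S i))) \<sigma>}"
  have "?R \<subseteq> DCG_perm ?D n S ` {\<sigma>. \<sigma> permutes {1..n}}"
    by (auto simp: orders_def)
  then have fin: "finite ?R"
    by (rule finite_subset) (intro finite_imageI finite_permutations, simp)
  \<comment> \<open>A constant ranking function makes all scores tie, so every permutation competes
    in the maximum.\<close>
  have R: "DCG_perm ?D n S \<sigma> \<in> ?R" if "\<sigma> permutes {1..n}" for \<sigma>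
    using that by (auto simp: orders_def intro!: exI[of _ \<sigma>] exI[of _ "\<lambda>_ :: 'x. 0 :: real"])
  have bin': "snd (S (\<sigma> r)) \<in> {0, 1}" if "\<sigma> permutes {1..n}" "r \<in> {1..n}" for \<sigma> r
    using bin permutes_in_image[OF that(1)] that(2) by blast
  have "DCG_perm ?D n S \<sigma> \<le> harm n" if "\<sigma> permutes {1..n}" for \<sigma>
    unfolding DCG_perm_def harm_def
  proof (rule sum_mono)
    fix r assume "r \<in> {1..n}"
    then show "snd (S (\<sigma> r)) * inverse (real r) \<le> inverse (real r)" using bin'[OF that, of r] by auto
  qed
  moreover have "?R \<noteq> {}" using R[OF permutes_id] by blast
  ultimately show "I \<le> harm n"
    unfolding I_def IDCG_def using fin by (subst Max_le_iff) (auto simp: orders_def)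
  obtain \<sigma> where \<sigma>: "\<sigma> permutes {1..n}" "\<And>r. r \<in> {1..card ?A} \<Longrightarrow> \<sigma> r \<in> ?A"
    using ex_permutes_initial_segment[of ?A n] by (metis (no_types, lifting) mem_Collect_eq subsetI)
  have "card ?A \<le> n" by (rule order_trans[OF card_mono[of "{1..n}"]]) auto
  then have sub: "{1..card ?A} \<subseteq> {1..n}" by (subst atLeastatMost_subset_iff) blast
  have "harm (card ?A) = (\<Sum>r=1..card ?A. snd (S (\<sigma> r)) * ?D r)"
    unfolding harm_def by (intro sum.cong) (use \<sigma>(2) in auto)
  also have "\<dots> \<le> DCG_perm ?D n S \<sigma>"
    unfolding DCG_perm_def
  proof (rule sum_mono2)
    fix r assume "r \<in> {1..n} - {1..card ?A}"
    then show "0 \<le> snd (S (\<sigma> r)) * inverse (real r)" using bin'[OF \<sigma>(1), of r] by auto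
  next
    show "{1..card ?A} \<subseteq> {1..n}" by (rule sub)
  qed simp
  also have "\<dots> \<le> I"
    unfolding I_def IDCG_def by (rule Max_ge[OF fin R[OF \<sigma>(1)]])
  finally show "harm (card ?A) \<le> I" .
qed

text \<open>The \<open>m\<close> points whose scores satisfy \<open>U\<close> occupy the first
  \<open>m\<close> positions, where errors are small. Each later position costs at most an extra
  \<open>C\<close> times its discount, in total \<open>C\<close> times a harmonic tail. A predicate
  closed upwards, rather than a threshold, covers open and closed half-lines alike.\<close>

lemma orders_weighted_sum_le:
  fixes e :: "nat \<Rightarrow> real"
  assumes ord: "orders n v \<sigma>" and up: "\<And>s t. U s \<Longrightarrow> s \<le> t \<Longrightarrow> U t"
    and C: "\<And>i. i \<in> {1..n} \<Longrightarrow> \<bar>e i\<bar> \<le> C"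
    and \<epsilon>: "0 \<le> \<epsilon>" "\<And>i. i \<in> {1..n} \<Longrightarrow> U (v i) \<Longrightarrow> \<bar>e i\<bar> \<le> \<epsilon>"
  defines "m \<equiv> card {i \<in> {1..n}. U (v i)}"
  shows "\<bar>\<Sum>r=1..n. e (\<sigma> r) * inverse (real r)\<bar> \<le> \<epsilon> * harm n + C * (harm n - harm m)"
proof -
  have perm: "\<sigma> permutes {1..n}" using ord by (simp add: orders_def)
  have \<sigma>: "\<sigma> r \<in> {1..n}" if "r \<in> {1..n}" for r
    using permutes_in_image[OF perm] that by blast
  have mn: "m \<le> n" unfolding m_def by (rule order_trans[OF card_mono[of "{1..n}"]]) auto
  \<comment> \<open>If position \<open>r\<close> holds a point outside \<open>U\<close>, every point
    of \<open>U\<close> stands strictly before it, since points from \<open>r\<close> on have no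
    larger scores. Counting positions through the injective \<open>inv \<sigma>\<close> gives
    \<open>m \<le> r - 1\<close>.\<close>
  have gt: "m < r" if r: "r \<in> {1..n}" "\<not> U (v (\<sigma> r))" for r
  proof -
    have "inj_on (inv \<sigma>) A" for A
      using permutes_inj[OF permutes_inv[OF perm]] inj_on_subset by blast
    moreover have "inv \<sigma> ` {i \<in> {1..n}. U (v i)} \<subseteq> {1..<r}"
    proof clarify
      fix i assume i: "i \<in> {1..n}" "U (v i)"
      have *: "inv \<sigma> i \<in> {1..n}" using permutes_in_image[OF permutes_inv[OF perm]] i by blast
      have "\<sigma> (inv \<sigma> i) = i" using permutes_inverses(1)[OF perm] .
      moreover have "v (\<sigma> (inv \<sigma> i)) \<le> v (\<sigma> r)" if "r \<le> inv \<sigma> i"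
        using ord r(1) * that unfolding orders_def by blast
      ultimately have "\<not> r \<le> inv \<sigma> i"
        using up[OF i(2)] r(2) by auto
      then show "inv \<sigma> i \<in> {1..<r}" using * by auto
    qed
    ultimately have "m \<le> card {1..<r}"
      unfolding m_def by (intro card_inj_on_le) auto
    then show ?thesis using r by auto
  qed
  have "\<bar>\<Sum>r=1..n. e (\<sigma> r) * inverse (real r)\<bar> \<le> (\<Sum>r=1..n. \<bar>e (\<sigma> r)\<bar> * inverse (real r))"
    by (rule order_trans[OF sum_abs]) (simp add: abs_mult)
  also have "\<dots> \<le> (\<Sum>r=1..n. \<epsilon> * inverse (real r) + (if m < r then C * inverse (real r) else 0))"
  proof (rule sum_mono)
    fix r assume r: "r \<in> {1..n}"
    have "\<bar>e (\<sigma> r)\<bar> \<le> \<epsilon> + (if m < r then C else 0)"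
      using C[OF \<sigma>[OF r]] \<epsilon>(1) \<epsilon>(2)[OF \<sigma>[OF r]] gt[OF r] by (cases "U (v (\<sigma> r))") auto
    then have "\<bar>e (\<sigma> r)\<bar> * inverse (real r) \<le> (\<epsilon> + (if m < r then C else 0)) * inverse (real r)"
      by (rule mult_right_mono) simp
    then show "\<bar>e (\<sigma> r)\<bar> * inverse (real r) \<le> \<epsilon> * inverse (real r) + (if m < r then C * inverse (real r) else 0)"
      by (auto simp: distrib_right split: if_splits)
  qed
  also have "\<dots> = \<epsilon> * harm n + C * (\<Sum>r\<in>{m<..n}. inverse (real r))"
  proof -
    have "{r \<in> {1..n}. m < r} = {m<..n}" by auto
    then show ?thesis
      by (simp add: sum.distrib harm_def sum_distrib_left sum.inter_filter[symmetric])
  qed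
  also have "(\<Sum>r\<in>{m<..n}. inverse (real r)) = harm n - harm m"
    using harm_diff[OF mn] by simp
  finally show ?thesis .
qed

section \<open>The law of a distribution function evaluated at its own variable\<close>

text \<open>The set \<open>T\<close> is closed downwards, hence empty, the whole line, or a
  half-line ending at some \<open>c\<close>. The mass of a half-line is the value or the left limit
  of the distribution function at \<open>c\<close>, and both are at most \<open>u\<close>. No
  continuity enters; equality may fail at jumps.\<close>

lemma (in real_distribution) measure_cdf_le:
  assumes "0 \<le> u"
  shows "measure M {t. cdf M t \<le> u} \<le> u"
proof -
  define T where "T = {t. cdf M t \<le> u}"
  have down: "s \<in> T" if "t \<in> T" "s \<le> t" for s t
    using that cdf_nondecreasing[of s t] by (simp add: T_def)
  consider "T = {}" | "T \<noteq> {}" "\<not> bdd_above T" | "T \<noteq> {}" "bdd_above T" by metis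
  then have "measure M T \<le> u"
  proof cases
    case 1
    then show ?thesis using assms by simp
  next
    case 2
    have "t \<in> T" for t
    proof -
      obtain s where "s \<in> T" "t < s" using 2(2) by (meson bdd_above.I not_le)
      then show ?thesis using down less_imp_le by blast
    qed
    \<comment> \<open>Now \<open>T\<close> is the whole line, so \<open>u\<close> bounds the
      distribution function everywhere and thus also its limit 1.\<close>
    then have "cdf M (real i) \<le> u" for i by (auto simp: T_def)
    then have "1 \<le> u"
      by (intro LIMSEQ_le_const2[OF cdf_lim_infty_prob]) auto
    then show ?thesis using prob_le_1 by (rule order_trans[rotated])
  next
    case 3
    define c where "c = Sup T"
    have lt: "t \<in> T" if "t < c" for t
      using that less_cSup_iff[OF 3] down unfolding c_def by (meson less_imp_le)
    have le: "t \<le> c" if "t \<in> T" for t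
      unfolding c_def using that 3(2) by (rule cSup_upper)
    show ?thesis
    proof (cases "c \<in> T")
      case True
      then have "T = {..c}" using lt le by (auto simp: order.order_iff_strict)
      moreover have "measure M {..c} \<le> u" using True by (simp add: T_def cdf_def2)
      ultimately show ?thesis by simp
    next
      case False
      then have "T = {..<c}" using lt le by (force simp: order.order_iff_strict)
      \<comment> \<open>The mass of the open half-line is the left limit at \<open>c\<close>, and
        \<open>u\<close> bounds all values to the left of \<open>c\<close>.\<close>
      moreover have "measure M {..<c} \<le> u"
        by (rule tendsto_upperbound[OF cdf_at_left])
          (use lt in \<open>auto simp: T_def eventually_at_left_field intro!: exI[of _ "c - 1"]\<close>)
      ultimately show ?thesis by simp
    qed
  qed
  then show ?thesis by (simp add: T_def)
qed

section \<open>Orthogonality of the noise to functions of the score\<close>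

text \<open>Half-lines are stable under intersection and generate the Borel sets, so a Dynkin
  argument extends \<open>atMost\<close> to all Borel sets. Then the conditional expectation of
  \<open>W\<close> given \<open>V\<close> is 0, and the factor \<open>h (V z)\<close> can be pulled
  out of it.\<close>

lemma (in prob_space) integral_borel_mult_eq_0:
  fixes V W :: "'a \<Rightarrow> real" and h :: "real \<Rightarrow> real"
  assumes V[measurable]: "V \<in> borel_measurable M" and W: "integrable M W"
    and W0: "(\<integral>z. W z \<partial>M) = 0"
    and atMost: "\<And>t. (\<integral>z. indicator {..t} (V z) * W z \<partial>M) = 0"
    and h[measurable]: "h \<in> borel_measurable borel" and bdd: "\<And>t. \<bar>h t\<bar> \<le> B"
  shows "(\<integral>z. h (V z) * W z \<partial>M) = 0"
proof -
  have [measurable]: "W \<in> borel_measurable M" using W by auto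
  have int: "integrable M (\<lambda>z. indicator A (V z) * W z)" if [measurable]: "A \<in> sets borel" for A
    by (rule Bochner_Integration.integrable_bound[OF W]) (auto simp: indicator_def)
  have ind: "(\<integral>z. indicator A (V z) * W z \<partial>M) = 0" if "A \<in> sets borel" for A
  proof -
    have "A \<in> sigma_sets UNIV (range (atMost :: real \<Rightarrow> real set))"
      using that by (simp add: borel_eq_atMost)
    have stable: "Int_stable (range (atMost :: real \<Rightarrow> real set))" by (auto simp: Int_stable_def)
    have sub: "range (atMost :: real \<Rightarrow> real set) \<subseteq> Pow UNIV" by simp
    show ?thesis
      using \<open>A \<in> sigma_sets UNIV (range atMost)\<close>
    proof (induction rule: sigma_sets_induct_disjoint[OF stable sub,
          consumes 1, case_names basic empty compl union])
      case (basic A)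
      then show ?case using atMost by auto
    next
      case empty
      then show ?case by simp
    next
      case (compl A)
      have A: "A \<in> sets borel" using compl(1) by (simp add: borel_eq_atMost)
      have "(\<integral>z. indicator (UNIV - A) (V z) * W z \<partial>M) = (\<integral>z. W z - indicator A (V z) * W z \<partial>M)"
        by (intro Bochner_Integration.integral_cong) (auto simp: indicator_def)
      then show ?case using compl(2) W0 int[OF A] W by simp
    next
      case (union A)
      have A[measurable]: "A i \<in> sets borel" for i using union(2) by (simp add: borel_eq_atMost image_subset_iff)
      define A' where "A' i = V -` A i \<inter> space M" for i
      have eq: "(\<integral>z. indicator D (V z) * W z \<partial>M) = (LINT z:(V -` D \<inter> space M)|M. W z)" for D
        unfolding set_lebesgue_integral_def
        by (intro Bochner_Integration.integral_cong) (auto simp: indicator_def)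
      \<comment> \<open>Countable additivity of the integral over the disjoint preimages.\<close>
      have "(LINT z:(\<Union>i. A' i)|M. W z) = (\<Sum>i. (LINT z:(A' i)|M. W z))"
      proof (rule lebesgue_integral_countable_add)
        show "set_integrable M (\<Union>i. A' i) W"
          unfolding set_integrable_def A'_def
          by (rule integrable_mult_indicator[OF _ W]) measurable
        show "A' i \<in> sets M" for i unfolding A'_def by measurable
        show "A' i \<inter> A' j = {}" if "i \<noteq> j" for i j
          using disjoint_family_onD[OF union(1), of i j] that unfolding A'_def by blast
      qed
      also have "\<dots> = 0" using union(3) by (simp add: A'_def eq[symmetric])
      also have "(\<Union>i. A' i) = V -` (\<Union>i. A i) \<inter> space M" by (auto simp: A'_def)
      finally show ?case by (simp add: eq)
    qed
  qed
  define F where "F = vimage_algebra (space M) V borel"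
  interpret finite_measure_subalgebra M F
    by unfold_locales (auto simp: F_def subalgebra_def sets_vimage_algebra2)
  have "AE z in M. real_cond_exp M F W z = 0"
  proof (rule real_cond_exp_charact)
    fix A assume "A \<in> sets F"
    then obtain D where D: "A = V -` D \<inter> space M" "D \<in> sets borel"
      by (auto simp: F_def sets_vimage_algebra2)
    have "(LINT z:A|M. W z) = (\<integral>z. indicator D (V z) * W z \<partial>M)"
      unfolding set_lebesgue_integral_def
      by (intro Bochner_Integration.integral_cong) (auto simp: indicator_def D)
    then show "(LINT z:A|M. W z) = (LINT z:A|M. 0)" using ind[OF D(2)] by simp
  qed (use W in auto)
  \<comment> \<open>Since \<open>h (V z)\<close> is measurable with respect to the \<sigma>-algebra
    generated by \<open>V\<close>, conditioning \<open>W\<close> does not change the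
    integral.\<close>
  moreover have "(\<integral>z. h (V z) * real_cond_exp M F W z \<partial>M) = (\<integral>z. h (V z) * W z \<partial>M)"
  proof (rule real_cond_exp_intg(2))
    show "integrable M (\<lambda>z. h (V z) * W z)"
      by (rule Bochner_Integration.integrable_bound[OF integrable_mult_right[OF W, of B]])
         (use bdd in \<open>auto simp: abs_mult intro!: mult_right_mono order_trans[OF bdd]\<close>)
    have "V \<in> F \<rightarrow>\<^sub>M borel" unfolding F_def by (rule measurable_vimage_algebra1) simp
    then show "(\<lambda>z. h (V z)) \<in> borel_measurable F" by measurable
  qed auto
  moreover have "(\<integral>z. h (V z) * real_cond_exp M F W z \<partial>M) = (\<integral>z. 0 \<partial>M)"
    by (rule integral_cong_AE) (use calculation(1) in \<open>auto elim: eventually_mono\<close>)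
  ultimately show ?thesis by simp
qed

section \<open>Second moments of weighted noise\<close>

text \<open>Integrate over coordinate \<open>i\<close> first, by Fubini. With the other coordinates
  fixed, \<open>W (x j)\<close> is a constant and \<open>g\<close> becomes a bounded function of the
  score \<open>V (x i)\<close>, to which \<open>W\<close> is orthogonal. It is essential that
  \<open>g\<close> sees only scores.\<close>

lemma (in prob_space) integral_PiM_orthogonal:
  fixes V W :: "'a \<Rightarrow> real" and g :: "('i \<Rightarrow> real) \<Rightarrow> real"
  assumes I: "finite I" "i \<in> I" "j \<in> I" "i \<noteq> j"
    and V[measurable]: "V \<in> borel_measurable M" and W[measurable]: "W \<in> borel_measurable M"
    and B: "\<And>z. z \<in> space M \<Longrightarrow> \<bar>W z\<bar> \<le> B"
    and zero: "\<And>h. h \<in> borel_measurable borel \<Longrightarrow> (\<And>t. \<bar>h t\<bar> \<le> C) \<Longrightarrow> (\<integral>z. h (V z) * W z \<partial>M) = 0"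
    and g[measurable]: "g \<in> borel_measurable (\<Pi>\<^sub>M i\<in>I. borel)"
    and C: "\<And>v. v \<in> space (\<Pi>\<^sub>M i\<in>I. (borel :: real measure)) \<Longrightarrow> \<bar>g v\<bar> \<le> C"
  shows "(\<integral>x. g (\<lambda>k\<in>I. V (x k)) * (W (x i) * W (x j)) \<partial>(\<Pi>\<^sub>M i\<in>I. M)) = 0"
proof -
  define J where "J = I - {i}"
  have I_eq: "I = insert i J" and J: "finite J" "i \<notin> J" "j \<in> J" using I by (auto simp: J_def)
  interpret product_prob_space "\<lambda>_. M" I ..
  have [measurable]: "(\<lambda>x. x k) \<in> (\<Pi>\<^sub>M i\<in>I. M) \<rightarrow>\<^sub>M M" if "k \<in> I" for k
    using that by measurable
  have [measurable]: "(\<lambda>x. \<lambda>k\<in>I. V (x k)) \<in> (\<Pi>\<^sub>M i\<in>I. M) \<rightarrow>\<^sub>M (\<Pi>\<^sub>M i\<in>I. borel)"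
    by (rule measurable_restrict) measurable
  let ?G = "\<lambda>x. g (\<lambda>k\<in>I. V (x k)) * (W (x i) * W (x j))"
  have "integrable (\<Pi>\<^sub>M i\<in>I. M) ?G"
  proof (rule P.integrable_const_bound[where B = "C * (B * B)"])
    show "AE x in \<Pi>\<^sub>M i\<in>I. M. norm (?G x) \<le> C * (B * B)"
    proof (rule AE_I2)
      fix x assume x: "x \<in> space (\<Pi>\<^sub>M i\<in>I. M)"
      then have "x i \<in> space M" "x j \<in> space M" using I by (auto simp: space_PiM)
      then have "\<bar>W (x i)\<bar> \<le> B" "\<bar>W (x j)\<bar> \<le> B" using B by auto
      moreover have "\<bar>g (\<lambda>k\<in>I. V (x k))\<bar> \<le> C" by (rule C) (auto simp: space_PiM)
      ultimately show "norm (?G x) \<le> C * (B * B)"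
        by (auto simp: abs_mult intro!: mult_mono)
    qed
    show "?G \<in> borel_measurable (\<Pi>\<^sub>M i\<in>I. M)" using I(2,3) by measurable
  qed
  then have "(\<integral>x. ?G x \<partial>(\<Pi>\<^sub>M i\<in>I. M)) = (\<integral>x. (\<integral>y. ?G (x(i := y)) \<partial>M) \<partial>(\<Pi>\<^sub>M i\<in>J. M))"
    unfolding I_eq by (intro product_integral_insert J)
  also have "\<dots> = (\<integral>x. 0 \<partial>(\<Pi>\<^sub>M i\<in>J. M))"
  proof (rule Bochner_Integration.integral_cong)
    fix x assume x: "x \<in> space (\<Pi>\<^sub>M i\<in>J. M)"
    define v where "v = (\<lambda>k\<in>J. V (x k))"
    have v: "v \<in> space (\<Pi>\<^sub>M i\<in>J. borel)" by (auto simp: v_def space_PiM)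
    \<comment> \<open>The weight as a function of the \<open>i\<close>-th score, with all other
      scores frozen.\<close>
    define h where "h t = g (v(i := t))" for t
    have "(\<lambda>t. v(i := t)) \<in> borel \<rightarrow>\<^sub>M (\<Pi>\<^sub>M i\<in>I. borel)"
      unfolding I_eq by (rule measurable_component_update[OF v J(2)])
    then have h: "h \<in> borel_measurable borel" unfolding h_def by measurable
    have hC: "\<bar>h t\<bar> \<le> C" for t
      unfolding h_def by (rule C) (use v in \<open>auto simp: space_PiM I_eq PiE_def extensional_def\<close>)
    have "(\<integral>y. ?G (x(i := y)) \<partial>M) = (\<integral>y. W (x j) * (h (V y) * W y) \<partial>M)"
    proof (rule Bochner_Integration.integral_cong)
      fix y
      have "(\<lambda>k\<in>I. V ((x(i := y)) k)) = v(i := V y)"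
        using J by (auto simp: v_def I_eq restrict_def)
      then show "?G (x(i := y)) = W (x j) * (h (V y) * W y)" using I by (simp add: h_def)
    qed simp
    also have "\<dots> = 0" using zero[OF h hC] by simp
    finally show "(\<integral>y. ?G (x(i := y)) \<partial>M) = 0" .
  qed simp
  finally show ?thesis by simp
qed

text \<open>Each weight may depend on all scores, so the summands need not be independent. They are
  still orthogonal: after expanding the square, the terms with \<open>i \<noteq> j\<close> integrate
  to 0, and the diagonal is at most \<open>B\<^sup>2\<close> times the sum of the squared
  weights.\<close>

lemma (in prob_space) second_moment_weighted_sum:
  fixes V W :: "'b \<Rightarrow> real" and b :: "'i \<Rightarrow> ('i \<Rightarrow> real) \<Rightarrow> real" and X :: "'i \<Rightarrow> 'a \<Rightarrow> 'b"
  assumes I: "finite I" "I \<noteq> {}" and P: "prob_space P"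
    and indep: "indep_vars (\<lambda>_. P) X I" and distr: "\<And>i. i \<in> I \<Longrightarrow> distr M P (X i) = P"
    and V[measurable]: "V \<in> borel_measurable P" and W[measurable]: "W \<in> borel_measurable P"
    and B: "\<And>z. z \<in> space P \<Longrightarrow> \<bar>W z\<bar> \<le> B"
    and zero: "\<And>h c. h \<in> borel_measurable borel \<Longrightarrow> (\<And>t. \<bar>h t\<bar> \<le> c) \<Longrightarrow> (\<integral>z. h (V z) * W z \<partial>P) = 0"
    and b[measurable]: "\<And>i. i \<in> I \<Longrightarrow> b i \<in> borel_measurable (\<Pi>\<^sub>M i\<in>I. borel)"
    and C: "\<And>v. v \<in> space (\<Pi>\<^sub>M i\<in>I. (borel :: real measure)) \<Longrightarrow> (\<Sum>i\<in>I. (b i v)\<^sup>2) \<le> C"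
  defines "S \<equiv> \<lambda>\<omega>. \<Sum>i\<in>I. b i (\<lambda>k\<in>I. V (X k \<omega>)) * W (X i \<omega>)"
  shows "S \<in> borel_measurable M" "integrable M (\<lambda>\<omega>. (S \<omega>)\<^sup>2)" "expectation (\<lambda>\<omega>. (S \<omega>)\<^sup>2) \<le> B\<^sup>2 * C"
proof -
  interpret P: prob_space P by fact
  interpret Q: product_prob_space "\<lambda>_. P" I ..
  let ?Q = "\<Pi>\<^sub>M i\<in>I. P"
  have X[measurable]: "X i \<in> M \<rightarrow>\<^sub>M P" if "i \<in> I" for i
    using indep that by (auto simp: indep_vars_def)
  have XI: "(\<lambda>\<omega>. \<lambda>i\<in>I. X i \<omega>) \<in> M \<rightarrow>\<^sub>M ?Q" by (rule measurable_restrict) (rule X)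
  \<comment> \<open>By independence the joint law of the sample is the product measure, so the
    computation can be done in coordinates.\<close>
  have QM: "distr M ?Q (\<lambda>\<omega>. \<lambda>i\<in>I. X i \<omega>) = ?Q"
    using indep_vars_iff_distr_eq_PiM'[where M' = "\<lambda>_. P", OF I(2) X] indep distr
    by (simp cong: PiM_cong)
  define v where "v x = (\<lambda>k\<in>I. V (x k))" for x :: "'i \<Rightarrow> 'b"
  define T where "T x = (\<Sum>i\<in>I. b i (v x) * W (x i))" for x
  have comp[measurable]: "(\<lambda>x. x k) \<in> ?Q \<rightarrow>\<^sub>M P" if "k \<in> I" for k
    using that by measurable
  have v[measurable]: "v \<in> ?Q \<rightarrow>\<^sub>M (\<Pi>\<^sub>M i\<in>I. borel)"
    unfolding v_def by (rule measurable_restrict) measurable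
  have T[measurable]: "T \<in> borel_measurable ?Q" unfolding T_def by measurable
  have ST: "S \<omega> = T (\<lambda>i\<in>I. X i \<omega>)" for \<omega>
    unfolding S_def T_def v_def by (auto intro!: sum.cong simp: restrict_def cong: if_cong)
  show S: "S \<in> borel_measurable M"
    unfolding ST by (rule measurable_compose[OF XI T])
  have vs: "v x \<in> space (\<Pi>\<^sub>M i\<in>I. borel)" for x by (auto simp: v_def space_PiM)
  have bC: "(b i u)\<^sup>2 \<le> C" if "i \<in> I" "u \<in> space (\<Pi>\<^sub>M i\<in>I. borel)" for i u
    using C[OF that(2)] member_le_sum[of i I "\<lambda>i. (b i u)\<^sup>2"] that I(1) by auto
  \<comment> \<open>The inequality \<open>2 * \<bar>a * b\<bar> \<le> a\<^sup>2 + b\<^sup>2\<close>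
    bounds the product weights uniformly, as integrability and the orthogonality of cross terms
    require.\<close>
  have bbC: "\<bar>b i u * b j u\<bar> \<le> C" if "i \<in> I" "j \<in> I" "u \<in> space (\<Pi>\<^sub>M i\<in>I. borel)" for i j u
  proof -
    have "0 \<le> (\<bar>b i u\<bar> - \<bar>b j u\<bar>)\<^sup>2" by simp
    then have "2 * \<bar>b i u * b j u\<bar> \<le> (b i u)\<^sup>2 + (b j u)\<^sup>2"
      by (simp add: power2_diff abs_mult)
    then show ?thesis using bC[OF that(1,3)] bC[OF that(2,3)] by linarith
  qed
  define G where "G i j x = (b i (v x) * b j (v x)) * (W (x i) * W (x j))" for i j x
  have WB: "\<bar>W (x i)\<bar> \<le> B" if "i \<in> I" "x \<in> space ?Q" for i x
    using that by (intro B) (auto simp: space_PiM)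
  have G_int: "integrable ?Q (G i j)" if ij: "i \<in> I" "j \<in> I" for i j
  proof (rule Q.P.integrable_const_bound[where B = "C * (B * B)"])
    show "AE x in ?Q. norm (G i j x) \<le> C * (B * B)"
    proof (rule AE_I2)
      fix x assume x: "x \<in> space ?Q"
      have "0 \<le> C" using bbC[OF ij vs] by (meson abs_ge_zero order_trans)
      moreover have "0 \<le> B" using WB[OF ij(1) x] by (meson abs_ge_zero order_trans)
      ultimately show "norm (G i j x) \<le> C * (B * B)"
        unfolding G_def real_norm_def abs_mult[of "b i (v x) * b j (v x)"] abs_mult[of "W (x i)"]
        by (intro mult_mono bbC vs WB ij x) auto
    qed
    show "G i j \<in> borel_measurable ?Q" unfolding G_def using ij by measurable
  qed
  have G0: "(\<integral>x. G i j x \<partial>?Q) = 0" if "i \<in> I" "j \<in> I" "i \<noteq> j" for i j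
    unfolding G_def v_def
    by (rule P.integral_PiM_orthogonal[OF I(1) that V W B zero, where C = C])
      (use that bbC in auto)
  have T2: "(T x)\<^sup>2 = (\<Sum>i\<in>I. \<Sum>j\<in>I. G i j x)" for x
    unfolding T_def G_def power2_eq_square sum_product by (intro sum.cong refl) (simp add: mult_ac)
  have T2_int: "integrable ?Q (\<lambda>x. (T x)\<^sup>2)"
    unfolding T2 by (intro Bochner_Integration.integrable_sum G_int)
  have "(\<integral>x. (T x)\<^sup>2 \<partial>?Q) = (\<Sum>i\<in>I. \<Sum>j\<in>I. \<integral>x. G i j x \<partial>?Q)"
    unfolding T2 by (simp add: G_int)
  also have "\<dots> = (\<Sum>i\<in>I. \<integral>x. G i i x \<partial>?Q)"
  proof (intro sum.cong refl)
    fix i assume "i \<in> I"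
    then have "(\<Sum>j\<in>I. \<integral>x. G i j x \<partial>?Q) = (\<Sum>j\<in>I. if j = i then \<integral>x. G i i x \<partial>?Q else 0)"
      by (intro sum.cong) (auto simp: G0)
    then show "(\<Sum>j\<in>I. \<integral>x. G i j x \<partial>?Q) = (\<integral>x. G i i x \<partial>?Q)"
      using \<open>i \<in> I\<close> I(1) by (simp add: sum.delta)
  qed
  also have "\<dots> = (\<integral>x. (\<Sum>i\<in>I. G i i x) \<partial>?Q)" by (simp add: G_int)
  also have "\<dots> \<le> (\<integral>x. B\<^sup>2 * C \<partial>?Q)"
  proof (rule integral_mono)
    fix x assume x: "x \<in> space ?Q"
    have "(\<Sum>i\<in>I. G i i x) \<le> (\<Sum>i\<in>I. (b i (v x))\<^sup>2 * B\<^sup>2)"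
      using WB[OF _ x] by (intro sum_mono)
       (auto simp: G_def power2_eq_square[symmetric] abs_le_square_iff[symmetric] intro!: mult_left_mono order_trans[OF _ abs_ge_self])
    also have "\<dots> \<le> B\<^sup>2 * C"
      using mult_left_mono[OF C[OF vs, of x] zero_le_power2[of B]]
      by (simp add: sum_distrib_left mult.commute)
    finally show "(\<Sum>i\<in>I. G i i x) \<le> B\<^sup>2 * C" .
  qed (auto intro!: Bochner_Integration.integrable_sum G_int)
  also have "\<dots> = B\<^sup>2 * C" by (simp add: Q.P.prob_space)
  finally have le: "(\<integral>x. (T x)\<^sup>2 \<partial>?Q) \<le> B\<^sup>2 * C" .
  have "integrable (distr M ?Q (\<lambda>\<omega>. \<lambda>i\<in>I. X i \<omega>)) (\<lambda>x. (T x)\<^sup>2)" using T2_int QM by simp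
  then show "integrable M (\<lambda>\<omega>. (S \<omega>)\<^sup>2)"
    unfolding ST using XI by (subst (asm) integrable_distr_eq) auto
  have "(\<integral>x. (T x)\<^sup>2 \<partial>?Q) = (\<integral>\<omega>. (S \<omega>)\<^sup>2 \<partial>M)"
    unfolding ST using XI by (subst QM[symmetric], subst integral_distr) auto
  then show "expectation (\<lambda>\<omega>. (S \<omega>)\<^sup>2) \<le> B\<^sup>2 * C" using le by simp
qed

text \<open>Conditioning on \<open>F V\<close> is as good as conditioning on \<open>V\<close>, because \<open>V \<le> t\<close> and \<open>F V \<le> F t\<close>
  differ by a null event: the former is contained in the latter, whose probability is at most
  \<open>F t\<close> even when \<open>F\<close> has jumps or flat pieces.\<close>

lemma (in prob_space) cond_exp_cdf_orthogonal:
  fixes V Y :: "'a \<Rightarrow> real" and g h :: "real \<Rightarrow> real"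
  defines "F \<equiv> cdf (distr M borel V)"
  assumes V[measurable]: "V \<in> borel_measurable M" and Y: "integrable M Y"
    and gF: "integrable M (\<lambda>z. g (F (V z)))"
    and cond: "AE z in M. real_cond_exp M (vimage_algebra (space M) (\<lambda>z. F (V z)) borel) Y z = g (F (V z))"
    and h: "h \<in> borel_measurable borel" "\<And>t. \<bar>h t\<bar> \<le> B"
  shows "(\<integral>z. h (V z) * (Y z - g (F (V z))) \<partial>M) = 0"
proof -
  interpret N: real_distribution "distr M borel V" by (intro real_distribution_distr V)
  have [measurable]: "Y \<in> borel_measurable M" "(\<lambda>z. g (F (V z))) \<in> borel_measurable M"
    using Y gF by auto
  have "mono F" unfolding F_def by (intro monoI N.cdf_nondecreasing)
  then have F[measurable]: "F \<in> borel_measurable borel" by (rule borel_measurable_mono)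
  let ?G = "vimage_algebra (space M) (\<lambda>z. F (V z)) borel"
  interpret finite_measure_subalgebra M ?G
    by unfold_locales (auto simp: subalgebra_def sets_vimage_algebra2)
  \<comment> \<open>Events determined by \<open>F V\<close> are handled by the defining property of
    the conditional expectation.\<close>
  have int0: "(\<integral>z. indicator D (F (V z)) * (Y z - g (F (V z))) \<partial>M) = 0" if D[measurable]: "D \<in> sets borel" for D
  proof -
    define A where "A = (\<lambda>z. F (V z)) -` D \<inter> space M"
    have A: "A \<in> sets ?G" by (auto simp: A_def sets_vimage_algebra2)
    have [measurable]: "A \<in> sets M" unfolding A_def by measurable
    have "(LINT z:A|M. Y z) = (LINT z:A|M. real_cond_exp M ?G Y z)"
      by (rule real_cond_exp_intA[OF Y A])
    also have "\<dots> = (LINT z:A|M. g (F (V z)))"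
      by (rule set_lebesgue_integral_cong_AE) (use cond in auto)
    finally have "(LINT z:A|M. Y z - g (F (V z))) = 0"
      using Y gF by (subst set_integral_diff)
        (auto simp: set_integrable_def intro!: integrable_mult_indicator[where 'b = real, simplified])
    moreover have "(LINT z:A|M. Y z - g (F (V z))) = (\<integral>z. indicator D (F (V z)) * (Y z - g (F (V z))) \<partial>M)"
      unfolding set_lebesgue_integral_def
      by (intro Bochner_Integration.integral_cong) (auto simp: A_def indicator_def)
    ultimately show ?thesis by simp
  qed
  show ?thesis
  proof (rule integral_borel_mult_eq_0[OF V _ _ _ h])
    show "integrable M (\<lambda>z. Y z - g (F (V z)))" using Y gF by simp
    show "(\<integral>z. Y z - g (F (V z)) \<partial>M) = 0" using int0[of UNIV] by simp
    fix t
    let ?A = "{z \<in> space M. F (V z) \<le> F t}" and ?A' = "{z \<in> space M. V z \<le> t}"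
    have "prob ?A \<le> F t"
    proof -
      have "prob ?A = measure (distr M borel V) {s. F s \<le> F t}"
        by (subst measure_distr) (auto intro!: arg_cong[where f = prob])
      then show ?thesis
        using N.measure_cdf_le[of "F t"] by (simp add: F_def N.cdf_nonneg)
    qed
    also have "F t = prob ?A'"
      unfolding F_def cdf_def by (subst measure_distr) (auto intro!: arg_cong[where f = prob])
    finally have le: "prob ?A \<le> prob ?A'" .
    have "?A' \<subseteq> ?A" using monoD[OF \<open>mono F\<close>] by auto
    moreover have [measurable]: "?A \<in> events" "?A' \<in> events" by measurable
    ultimately have "prob (?A - ?A') = prob ?A - prob ?A'" by (intro finite_measure_Diff)
    with le have "prob (?A - ?A') = 0" using measure_nonneg[of M "?A - ?A'"] by linarith
    then have "AE z in M. z \<notin> ?A - ?A'" by (subst (asm) prob_eq_0) auto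
    then have "AE z in M. V z \<le> t \<longleftrightarrow> F (V z) \<le> F t"
      using monoD[OF \<open>mono F\<close>] by (auto elim!: eventually_mono)
    then have "(\<integral>z. indicator {..t} (V z) * (Y z - g (F (V z))) \<partial>M)
        = (\<integral>z. indicator {..F t} (F (V z)) * (Y z - g (F (V z))) \<partial>M)"
      by (intro integral_cong_AE) (auto elim!: eventually_mono simp: indicator_def)
    then show "(\<integral>z. indicator {..t} (V z) * (Y z - g (F (V z))) \<partial>M) = 0"
      using int0[of "{..F t}"] by simp
  qed
qed

section \<open>Probabilities of untypical samples\<close>

text \<open>Chebyshev's inequality: the count minus \<open>q * n\<close> has second moment at most
  \<open>n\<close>, while the event forces a deviation of at least \<open>q / 2 * n\<close>. The
  moment bound is the preceding lemma with all weights equal to 1.\<close>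

lemma (in prob_space) prob_count_le_half:
  fixes X :: "nat \<Rightarrow> 'a \<Rightarrow> 'b"
  assumes n: "0 < n" and P: "prob_space P"
    and indep: "indep_vars (\<lambda>_. P) X {1..n}" and distr: "\<And>i. i \<in> {1..n} \<Longrightarrow> distr M P (X i) = P"
    and A[measurable]: "A \<in> sets P" and q: "q = measure P A" "0 < q"
  defines "E \<equiv> {\<omega> \<in> space M. real (card {i \<in> {1..n}. X i \<omega> \<in> A}) \<le> q / 2 * real n}"
  shows "E \<in> events" "prob E \<le> 4 / q\<^sup>2 * inverse (real n)"
proof -
  interpret P: prob_space P by fact
  define W where "W z = indicator A z - q" for z
  define S where "S = (\<lambda>\<omega>. \<Sum>i\<in>{1..n}. 1 * W (X i \<omega>))"
  have q1: "q \<le> 1" using q by simp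
  \<comment> \<open>For the constant score 0, orthogonality to functions of the score just says that
    \<open>W\<close> has mean 0.\<close>
  have zero: "(\<integral>z. h 0 * W z \<partial>P) = 0" for h :: "real \<Rightarrow> real"
  proof -
    have "(\<integral>z. W z \<partial>P) = 0"
      unfolding W_def by (subst Bochner_Integration.integral_diff) (auto simp: q P.prob_space P.emeasure_eq_measure)
    then show ?thesis by simp
  qed
  have W1: "\<bar>W z\<bar> \<le> 1" for z using q1 q(2) by (auto simp: W_def indicator_def)
  have W[measurable]: "W \<in> borel_measurable P" unfolding W_def by measurable
  have ne: "{1..n} \<noteq> {}" using n by simp
  have V: "(\<lambda>_. 0 :: real) \<in> borel_measurable P" and C: "(\<Sum>i\<in>{1..n}. (1::real)\<^sup>2) \<le> real n"
    and b: "(\<lambda>_. 1 :: real) \<in> borel_measurable (\<Pi>\<^sub>M i\<in>{1..n}. borel)" by simp_all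
  note sm = second_moment_weighted_sum[where I = "{1..n}" and P = P and X = X
      and b = "\<lambda>_ _. 1" and V = "\<lambda>_. 0" and W = W and B = 1 and C = "real n",
      OF finite_atLeastAtMost ne P indep distr V W]
  have S[measurable]: "S \<in> borel_measurable M" unfolding S_def by (rule sm(1)) (use W1 zero b C in auto)
  have S2: "integrable M (\<lambda>\<omega>. (S \<omega>)\<^sup>2)" unfolding S_def by (rule sm(2)) (use W1 zero b C in auto)
  have "expectation (\<lambda>\<omega>. (S \<omega>)\<^sup>2) \<le> 1\<^sup>2 * real n" unfolding S_def by (rule sm(3)) (use W1 zero b C in auto)
  then have S2_le: "expectation (\<lambda>\<omega>. (S \<omega>)\<^sup>2) \<le> real n" by simp
  have S_eq: "S \<omega> = real (card {i \<in> {1..n}. X i \<omega> \<in> A}) - q * real n" for \<omega>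
  proof -
    have "real (card {i \<in> {1..n}. X i \<omega> \<in> A}) = (\<Sum>i\<in>{i \<in> {1..n}. X i \<omega> \<in> A}. 1)" by simp
    also have "\<dots> = (\<Sum>i\<in>{1..n}. indicator A (X i \<omega>))"
      unfolding sum.inter_filter[OF finite_atLeastAtMost] by (intro sum.cong) (auto simp: indicator_def)
    finally have "(\<Sum>i\<in>{1..n}. indicator A (X i \<omega>)) = real (card {i \<in> {1..n}. X i \<omega> \<in> A})" ..
    then show ?thesis by (simp add: S_def W_def sum_subtractf)
  qed
  have E: "E = {\<omega> \<in> space M. S \<omega> \<le> - (q / 2 * real n)}"
    unfolding E_def S_eq by (auto simp: algebra_simps)
  then show "E \<in> events" by simp
  have "E \<subseteq> {\<omega> \<in> space M. q / 2 * real n \<le> \<bar>S \<omega>\<bar>}" unfolding E by auto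
  then have "prob E \<le> prob {\<omega> \<in> space M. q / 2 * real n \<le> \<bar>S \<omega>\<bar>}"
    by (intro finite_measure_mono) auto
  also have "\<dots> \<le> expectation (\<lambda>\<omega>. (S \<omega>)\<^sup>2) / (q / 2 * real n)\<^sup>2"
    using q(2) n by (intro second_moment_method S S2) auto
  also have "\<dots> \<le> real n / (q / 2 * real n)\<^sup>2"
    using S2_le by (intro divide_right_mono) auto
  also have "\<dots> = 4 / q\<^sup>2 * inverse (real n)"
    using n q(2) by (simp add: field_simps power2_eq_square)
  finally show "prob E \<le> 4 / q\<^sup>2 * inverse (real n)" .
qed

text \<open>Summing over sample points instead of positions turns the discounts into random weights, which
  depend on the scores alone.\<close>

lemma (in prob_space) prob_ranked_sum_ge:
  fixes X :: "nat \<Rightarrow> 'a \<Rightarrow> 'b" and V W :: "'b \<Rightarrow> real"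
  assumes n: "0 < n" and P: "prob_space P"
    and indep: "indep_vars (\<lambda>_. P) X {1..n}" and distr: "\<And>i. i \<in> {1..n} \<Longrightarrow> distr M P (X i) = P"
    and V: "V \<in> borel_measurable P" and W: "W \<in> borel_measurable P"
    and B: "\<And>z. z \<in> space P \<Longrightarrow> \<bar>W z\<bar> \<le> B"
    and zero: "\<And>h c. h \<in> borel_measurable borel \<Longrightarrow> (\<And>t. \<bar>h t\<bar> \<le> c) \<Longrightarrow> (\<integral>z. h (V z) * W z \<partial>P) = 0"
    and \<rho>: "ordering_rule \<rho>" and a: "0 < a"
  defines "T \<equiv> \<lambda>\<omega>. \<Sum>r=1..n. W (X (\<rho> n (\<lambda>i\<in>{1..n}. V (X i \<omega>)) r) \<omega>) * inverse (real r)"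
  shows "T \<in> borel_measurable M" "prob {\<omega> \<in> space M. a * harm n \<le> \<bar>T \<omega>\<bar>} \<le> B\<^sup>2 / a\<^sup>2 * inverse (harm n)"
proof -
  \<comment> \<open>The inverse permutation sends a point to its position, so \<open>b i v\<close>
    is the discount that point \<open>i\<close> receives.\<close>
  define b where "b i v = inverse (real (inv (\<rho> n v) i))" for i v
  have \<rho>_meas: "\<rho> n \<in> (\<Pi>\<^sub>M i\<in>{1..n}. borel) \<rightarrow>\<^sub>M count_space {\<sigma>. \<sigma> permutes {1..n}}"
    using \<rho> unfolding ordering_rule_def by blast
  have perm: "\<rho> n v permutes {1..n}" if "v \<in> space (\<Pi>\<^sub>M i\<in>{1..n}. borel)" for v
    using \<rho> that unfolding ordering_rule_def orders_def by blast
  have b: "b i \<in> borel_measurable (\<Pi>\<^sub>M i\<in>{1..n}. borel)" for i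
    unfolding b_def by (rule measurable_compose[OF \<rho>_meas]) simp
  \<comment> \<open>The weights are a rearrangement of the discounts. Bounding
    \<open>1 / r\<^sup>2\<close> by \<open>1 / r\<close> is enough here, because
    \<open>harm n\<close> is still negligible against \<open>(harm n)\<^sup>2\<close>.\<close>
  have b2: "(\<Sum>i\<in>{1..n}. (b i v)\<^sup>2) \<le> harm n" if v: "v \<in> space (\<Pi>\<^sub>M i\<in>{1..n}. borel)" for v
  proof -
    have "(\<Sum>i\<in>{1..n}. (b i v)\<^sup>2) = (\<Sum>r\<in>{1..n}. (inverse (real r))\<^sup>2)"
      unfolding b_def by (rule sum.permute[OF permutes_inv[OF perm[OF v]], unfolded o_def, symmetric])
    also have "\<dots> \<le> (\<Sum>r\<in>{1..n}. inverse (real r))"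
      by (intro sum_mono) (auto simp: power2_eq_square field_simps)
    finally show ?thesis by (simp add: harm_def)
  qed
  have T_eq: "T = (\<lambda>\<omega>. \<Sum>i\<in>{1..n}. b i (\<lambda>k\<in>{1..n}. V (X k \<omega>)) * W (X i \<omega>))"
  proof
    fix \<omega>
    let ?\<sigma> = "\<rho> n (\<lambda>k\<in>{1..n}. V (X k \<omega>))"
    have p: "?\<sigma> permutes {1..n}" by (rule perm) (auto simp: space_PiM)
    have "(\<Sum>i\<in>{1..n}. b i (\<lambda>k\<in>{1..n}. V (X k \<omega>)) * W (X i \<omega>))
        = (\<Sum>r\<in>{1..n}. b (?\<sigma> r) (\<lambda>k\<in>{1..n}. V (X k \<omega>)) * W (X (?\<sigma> r) \<omega>))"
      by (rule sum.permute[OF p, unfolded o_def])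
    also have "\<dots> = T \<omega>"
      unfolding T_def b_def permutes_inverses(2)[OF p] by (simp add: mult.commute)
    finally show "T \<omega> = (\<Sum>i\<in>{1..n}. b i (\<lambda>k\<in>{1..n}. V (X k \<omega>)) * W (X i \<omega>))" by simp
  qed
  have ne: "{1..n} \<noteq> {}" using n by simp
  note sm = second_moment_weighted_sum[where V = V and W = W and B = B and C = "harm n",
      OF finite_atLeastAtMost ne P indep distr V W B zero b b2]
  show T: "T \<in> borel_measurable M" unfolding T_eq by (rule sm(1)) assumption+
  have T2: "integrable M (\<lambda>\<omega>. (T \<omega>)\<^sup>2)" unfolding T_eq by (rule sm(2)) assumption+
  have T2_le: "expectation (\<lambda>\<omega>. (T \<omega>)\<^sup>2) \<le> B\<^sup>2 * harm n" unfolding T_eq by (rule sm(3)) assumption+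
  have pos: "0 < a * harm n" using a n by (simp add: harm_pos)
  have "prob {\<omega> \<in> space M. a * harm n \<le> \<bar>T \<omega>\<bar>} \<le> expectation (\<lambda>\<omega>. (T \<omega>)\<^sup>2) / (a * harm n)\<^sup>2"
    by (rule second_moment_method[OF T T2 pos])
  also have "\<dots> \<le> (B\<^sup>2 * harm n) / (a * harm n)\<^sup>2"
    by (intro divide_right_mono T2_le) auto
  also have "\<dots> = B\<^sup>2 / a\<^sup>2 * inverse (harm n)"
    using pos a by (simp add: field_simps power2_eq_square)
  finally show "prob {\<omega> \<in> space M. a * harm n \<le> \<bar>T \<omega>\<bar>} \<le> B\<^sup>2 / a\<^sup>2 * inverse (harm n)" .
qed

section \<open>From the bounds to the limit\<close>

lemma canonical_eq_cdf:
  assumes fst: "fst \<in> P \<rightarrow>\<^sub>M MX" and f: "f \<in> borel_measurable MX"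
  shows "canonical (distr P MX fst) f x = cdf (distr P borel (\<lambda>z. f (fst z))) (f x)"
proof -
  have [measurable]: "(\<lambda>z. f (fst z)) \<in> borel_measurable P"
    by (rule measurable_compose[OF fst f])
  have "{x' \<in> space MX. f x' \<le> f x} \<in> sets MX" using f by measurable
  then have "canonical (distr P MX fst) f x = measure P (fst -` {x' \<in> space MX. f x' \<le> f x} \<inter> space P)"
    unfolding canonical_def space_distr by (rule measure_distr[OF fst])
  also have "fst -` {x' \<in> space MX. f x' \<le> f x} \<inter> space P = (\<lambda>z. f (fst z)) -` {..f x} \<inter> space P"
    using measurable_space[OF fst] by auto
  also have "measure P \<dots> = cdf (distr P borel (\<lambda>z. f (fst z))) (f x)"
    unfolding cdf_def by (subst measure_distr) auto
  finally show ?thesis .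
qed

text \<open>Comparing \<open>D\<close> with \<open>c * I\<close> instead of \<open>c * L\<close>
  costs only the constant \<open>\<bar>c\<bar> * C\<^sub>2\<close>. The second lower bound on
  \<open>L\<close> is exactly what lets the spare \<open>\<epsilon> / 2 * L\<close> absorb all
  constants, including the loss in \<open>\<epsilon> * (L - C\<^sub>2) \<le> \<epsilon> * I\<close>;
  the first one makes \<open>I\<close> positive.\<close>

lemma abs_ratio_diff_le:
  fixes D I L c \<epsilon> C\<^sub>1 C\<^sub>2 :: real
  assumes D: "\<bar>D - c * L\<bar> \<le> \<epsilon> / 2 * L + C\<^sub>1" and I: "L - C\<^sub>2 \<le> I" "I \<le> L"
    and \<epsilon>: "0 < \<epsilon>" and L: "C\<^sub>2 < L" "2 * (C\<^sub>1 + \<bar>c\<bar> * C\<^sub>2 + \<epsilon> * C\<^sub>2) / \<epsilon> \<le> L"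
  shows "\<bar>D / I - c\<bar> \<le> \<epsilon>"
proof -
  have pos: "0 < I" using I L by linarith
  have "\<bar>D - c * I\<bar> \<le> \<bar>D - c * L\<bar> + \<bar>c * (L - I)\<bar>"
    by (simp add: algebra_simps)
  also have "\<bar>c * (L - I)\<bar> \<le> \<bar>c\<bar> * C\<^sub>2"
    using I by (simp add: abs_mult mult_left_mono)
  also have "\<bar>D - c * L\<bar> + \<bar>c\<bar> * C\<^sub>2 \<le> \<epsilon> * (L - C\<^sub>2)"
    using D L(2) \<epsilon> by (simp add: field_simps)
  also have "\<dots> \<le> \<epsilon> * I" using I \<epsilon> by (intro mult_left_mono) auto
  finally have "\<bar>D - c * I\<bar> / I \<le> \<epsilon>" using pos by (simp add: field_simps)
  moreover have "D / I - c = (D - c * I) / I" using pos by (simp add: field_simps)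
  ultimately show ?thesis using pos by (simp add: abs_divide)
qed

theorem theorem5:
  fixes MX :: "'x measure"
    and P :: "('x \<times> real) measure"
    and M :: "'w measure"
    and Z :: "nat \<Rightarrow> 'w \<Rightarrow> 'x \<times> real"
    and f :: "'x \<Rightarrow> real"
    and ybar :: "real \<Rightarrow> real"
    and \<rho> :: "nat \<Rightarrow> (nat \<Rightarrow> real) \<Rightarrow> nat \<Rightarrow> nat"
  assumes "prob_space P"
    and "sets P = sets (MX \<Otimes>\<^sub>M count_space {0, 1})"
    and "prob_space M"
    and "prob_space.indep_vars M (\<lambda>_. P) Z {1..}"
    and "\<And>i. i \<ge> 1 \<Longrightarrow> distr M P (Z i) = P"
    and "f \<in> borel_measurable MX"
    and "ordering_rule \<rho>"
    and "measure P {z \<in> space P. snd z = 1} > 0"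
    and "cond_prob_label P (canonical (distr P MX fst) f) ybar"
    and "continuous_on {0..1} ybar"
  shows "converges_in_prob M (\<lambda>n \<omega>. NDCG \<rho> (\<lambda>r. inverse (real r)) f n (\<lambda>i. Z i \<omega>)) (ybar 1)"
proof -
  interpret P: prob_space P by fact
  interpret M: prob_space M by fact
  have spP: "space P = space MX \<times> {0, 1}"
    using sets_eq_imp_space_eq[OF assms(2)] by (simp add: space_pair_measure)
  have fst: "fst \<in> P \<rightarrow>\<^sub>M MX"
    using measurable_fst[of MX "count_space {0, 1 :: real}"] by (subst measurable_cong_sets[OF assms(2) refl])
  have "snd \<in> P \<rightarrow>\<^sub>M count_space {0, 1 :: real}"
    using measurable_snd[of MX "count_space {0, 1 :: real}"] by (subst measurable_cong_sets[OF assms(2) refl])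
  then have snd[measurable]: "snd \<in> borel_measurable P"
    by (rule measurable_compose[where g = "\<lambda>y. y"]) simp
  define V where "V z = f (fst z)" for z :: "'x \<times> real"
  have V[measurable]: "V \<in> borel_measurable P"
    unfolding V_def by (rule measurable_compose[OF fst assms(6)])
  define F where "F = cdf (distr P borel V)"
  interpret N: real_distribution "distr P borel V" by (intro P.real_distribution_distr V)
  have canonical: "canonical (distr P MX fst) f x = F (f x)" for x
    unfolding F_def V_def by (rule canonical_eq_cdf[OF fst assms(6)])
  have mono: "F s \<le> F t" if "s \<le> t" for s t
    unfolding F_def using that by (rule N.cdf_nondecreasing)
  then have F[measurable]: "F \<in> borel_measurable borel" by (intro borel_measurable_mono monoI)
  have F01: "F t \<in> {0..1}" for t unfolding F_def by (simp add: N.cdf_nonneg N.cdf_bounded_prob)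
  \<comment> \<open>Clamping the argument to the unit interval extends \<open>ybar\<close>
    continuously to the line, which gives Borel measurability; on values of \<open>F\<close> nothing
    changes.\<close>
  define g where "g s = ybar (max 0 (min 1 s))" for s
  have "continuous_on UNIV g"
    unfolding g_def by (rule continuous_on_compose2[OF assms(10)]) (auto intro!: continuous_intros)
  then have [measurable]: "g \<in> borel_measurable borel" by (rule borel_measurable_continuous_onI)
  have g: "g (F t) = ybar (F t)" for t using F01[of t] by (simp add: g_def)
  have "bounded (ybar ` {0..1})"
    by (intro compact_imp_bounded compact_continuous_image assms(10)) simp
  then obtain C where "\<And>y. y \<in> ybar ` {0..1} \<Longrightarrow> \<bar>y\<bar> \<le> C" by (auto simp: bounded_real)
  then have C: "\<bar>ybar s\<bar> \<le> C" if "s \<in> {0..1}" for s using that by blast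
  define W where "W z = snd z - g (F (V z))" for z :: "'x \<times> real"
  have W[measurable]: "W \<in> borel_measurable P" unfolding W_def by measurable
  have W_bdd: "\<bar>W z\<bar> \<le> 1 + C" if "z \<in> space P" for z
    using that C[OF F01, of "V z"] by (auto simp: W_def g spP)
  \<comment> \<open>For binary labels the indicator of label 1 is the label itself, so
    \<open>W\<close> is the label minus its conditional probability.\<close>
  have zero: "(\<integral>z. h (V z) * W z \<partial>P) = 0"
    if h: "h \<in> borel_measurable borel" "\<And>t. \<bar>h t\<bar> \<le> b" for h :: "real \<Rightarrow> real" and b
  proof -
    have A[measurable]: "{z \<in> space P. snd z = 1} \<in> sets P" by measurable
    have "(\<integral>z. h (V z) * (indicator {z \<in> space P. snd z = 1} z - g (cdf (distr P borel V) (V z))) \<partial>P) = 0"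
    proof (rule P.cond_exp_cdf_orthogonal[OF V _ _ _ h])
      show "integrable P (indicator {z \<in> space P. snd z = 1} :: _ \<Rightarrow> real)"
        by (rule P.integrable_const_bound[where B = 1]) auto
      show "integrable P (\<lambda>z. g (cdf (distr P borel V) (V z)))"
        unfolding F_def[symmetric]
        by (rule P.integrable_const_bound[where B = C, OF AE_I2]) (simp add: g C[OF F01], measurable)
      show "AE z in P. real_cond_exp P (vimage_algebra (space P) (\<lambda>z. cdf (distr P borel V) (V z)) borel)
          (indicator {z \<in> space P. snd z = 1}) z = g (cdf (distr P borel V) (V z))"
        using assms(9) by (simp add: cond_prob_label_def canonical F_def[symmetric] g V_def[symmetric])
    qed
    also have "(\<integral>z. h (V z) * (indicator {z \<in> space P. snd z = 1} z - g (cdf (distr P borel V) (V z))) \<partial>P)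
        = (\<integral>z. h (V z) * W z \<partial>P)"
      by (intro Bochner_Integration.integral_cong) (auto simp: W_def F_def spP)
    finally show ?thesis .
  qed
  have Z: "Z i \<omega> \<in> space P" if "1 \<le> i" "\<omega> \<in> space M" for i \<omega>
    using assms(4) that by (auto simp: M.indep_vars_def dest: measurable_space)
  have indep: "M.indep_vars (\<lambda>_. P) Z {1..n}" for n
    by (rule M.indep_vars_subset[OF assms(4)]) auto
  have distr: "distr M P (Z i) = P" if "i \<in> {1..n}" for i n using that assms(5) by auto
  show ?thesis
    unfolding converges_in_prob_def
  proof (intro allI impI)
    fix \<epsilon> :: real assume \<epsilon>: "0 < \<epsilon>"
    \<comment> \<open>One \<open>\<epsilon> / 4\<close> is for the deviation of \<open>ybar\<close>
      near 1 and another for the noise; the remaining \<open>\<epsilon> / 2\<close> absorbs bounded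
      terms.\<close>
    obtain \<delta>' where \<delta>': "0 < \<delta>'" "\<And>s. s \<in> {0..1} \<Longrightarrow> dist s 1 < \<delta>' \<Longrightarrow> dist (ybar s) (ybar 1) < \<epsilon> / 4"
      using assms(10)[unfolded continuous_on_iff, rule_format, of 1 "\<epsilon> / 4"] \<epsilon> by auto
    \<comment> \<open>The cap at 1 keeps \<open>1 - \<delta>\<close> nonnegative, as
      \<open>measure_cdf_le\<close> demands.\<close>
    define \<delta> where "\<delta> = min \<delta>' 1"
    have \<delta>: "0 < \<delta>" "\<delta> \<le> 1" using \<delta>' by (auto simp: \<delta>_def)
    have near: "\<bar>ybar s - ybar 1\<bar> \<le> \<epsilon> / 4" if "s \<in> {0..1}" "1 - \<delta> < s" for s
    proof -
      have "\<delta> \<le> \<delta>'" by (simp add: \<delta>_def)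
      then have "dist s 1 < \<delta>'" using that by (simp add: dist_real_def)
      then show ?thesis using \<delta>'(2)[OF that(1)] by (simp add: dist_real_def)
    qed
    define A1 where "A1 = {z \<in> space P. 1 - \<delta> < F (V z)}"
    define A2 where "A2 = {z \<in> space P. snd z = 1}"
    define q1 where "q1 = measure P A1"
    define q2 where "q2 = measure P A2"
    have A[measurable]: "A1 \<in> sets P" "A2 \<in> sets P" unfolding A1_def A2_def by measurable
    \<comment> \<open>Canonical scores of at most \<open>1 - \<delta>\<close> have probability at
      most \<open>1 - \<delta>\<close>, so \<open>A1\<close> has probability at least
      \<open>\<delta>\<close>, whatever the law of \<open>f X\<close>.\<close>
    have "P.prob (space P - A1) \<le> 1 - \<delta>"
    proof -
      have "P.prob (space P - A1) = measure (distr P borel V) {t. F t \<le> 1 - \<delta>}"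
        by (subst measure_distr) (auto simp: A1_def intro!: arg_cong[where f = P.prob])
      then show ?thesis using N.measure_cdf_le[of "1 - \<delta>"] \<delta> by (simp add: F_def)
    qed
    then have q1: "0 < q1" using \<delta> P.prob_compl[OF A(1)] by (simp add: q1_def)
    have q2: "0 < q2" using assms(8) by (simp add: q2_def A2_def)
    define \<sigma> where "\<sigma> n \<omega> = \<rho> n (\<lambda>i\<in>{1..n}. V (Z i \<omega>))" for n \<omega>
    define T where "T n \<omega> = (\<Sum>r=1..n. W (Z (\<sigma> n \<omega> r) \<omega>) * inverse (real r))" for n \<omega>
    \<comment> \<open>\<open>E A q n\<close>: the set \<open>A\<close> is hit at most half as often
      as expected. \<open>E3 n\<close>: the noise is not small. Outside \<open>E A1 q1 n\<close>,
      \<open>E A2 q2 n\<close> and \<open>E3 n\<close> the argument is deterministic.\<close>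
    define E where "E A q n = {\<omega> \<in> space M. real (card {i \<in> {1..n}. Z i \<omega> \<in> A}) \<le> q / 2 * real n}"
      for A :: "('x \<times> real) set" and q n
    define E3 where "E3 n = {\<omega> \<in> space M. \<epsilon> / 4 * harm n \<le> \<bar>T n \<omega>\<bar>}" for n
    define bad where
      "bad n = {\<omega> \<in> space M. \<bar>NDCG \<rho> (\<lambda>r. inverse (real r)) f n (\<lambda>i. Z i \<omega>) - ybar 1\<bar> > \<epsilon>}" for n
    have E12: "E A q n \<in> M.events" "M.prob (E A q n) \<le> 4 / q\<^sup>2 * inverse (real n)"
      if "A \<in> sets P" "q = measure P A" "0 < q" "0 < n" for A q n
      unfolding E_def by (rule M.prob_count_le_half[OF that(4) assms(1) indep distr that(1-3)], assumption)+
    have E3: "E3 n \<in> M.events" "M.prob (E3 n) \<le> (1 + C)\<^sup>2 / (\<epsilon> / 4)\<^sup>2 * inverse (harm n)" if "0 < n" for n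
    proof -
      have e4: "0 < \<epsilon> / 4" using \<epsilon> by simp
      note * = M.prob_ranked_sum_ge[where V = V and W = W and B = "1 + C",
          OF that assms(1) indep distr V W W_bdd zero assms(7) e4, folded \<sigma>_def, folded T_def]
      have [measurable]: "T n \<in> borel_measurable M"
        unfolding T_def \<sigma>_def by (rule *(1)[unfolded T_def \<sigma>_def]) assumption+
      then show "E3 n \<in> M.events" unfolding E3_def by measurable
      show "M.prob (E3 n) \<le> (1 + C)\<^sup>2 / (\<epsilon> / 4)\<^sup>2 * inverse (harm n)"
        unfolding E3_def by (rule *(2)) assumption+
    qed
    \<comment> \<open>Both constants come from \<open>harm_diff_le\<close> with proportions
      \<open>q1 / 2\<close> and \<open>q2 / 2\<close>; the factor \<open>2 * C\<close> bounds the
      difference of two values of \<open>ybar\<close>.\<close>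
    define C\<^sub>1 where "C\<^sub>1 = 2 * C * (1 / (q1 / 2))"
    define C\<^sub>2 where "C\<^sub>2 = 1 / (q2 / 2)"
    \<comment> \<open>The two thresholds of \<open>abs_ratio_diff_le\<close>; the summand 1 makes
      the first inequality strict.\<close>
    define N0 where "N0 = max (C\<^sub>2 + 1) (2 * (C\<^sub>1 + \<bar>ybar 1\<bar> * C\<^sub>2 + \<epsilon> * C\<^sub>2) / \<epsilon>)"
    have C0: "0 \<le> C" using C[of 1] by auto
    have sub: "bad n \<subseteq> E A1 q1 n \<union> E A2 q2 n \<union> E3 n" if n: "0 < n" "N0 \<le> harm n" for n
    proof
      fix \<omega> assume bad: "\<omega> \<in> bad n"
      then have \<omega>: "\<omega> \<in> space M" by (simp add: bad_def)
      show "\<omega> \<in> E A1 q1 n \<union> E A2 q2 n \<union> E3 n"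
      proof (rule ccontr)
        assume not: "\<omega> \<notin> E A1 q1 n \<union> E A2 q2 n \<union> E3 n"
        define m where "m = card {i \<in> {1..n}. Z i \<omega> \<in> A1}"
        define K where "K = card {i \<in> {1..n}. Z i \<omega> \<in> A2}"
        have "\<not> real m \<le> q1 / 2 * real n" using not \<omega> unfolding E_def m_def by blast
        moreover have "card {i \<in> {1..n}. Z i \<omega> \<in> A1} \<le> card {1..n}" by (rule card_mono) auto
        ultimately have m: "q1 / 2 * real n \<le> real m" "m \<le> n" by (simp_all add: m_def)
        have "\<not> real K \<le> q2 / 2 * real n" using not \<omega> unfolding E_def K_def by blast
        moreover have "card {i \<in> {1..n}. Z i \<omega> \<in> A2} \<le> card {1..n}" by (rule card_mono) auto
        ultimately have K: "q2 / 2 * real n \<le> real K" "K \<le> n" by (simp_all add: K_def)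
        have T: "\<bar>T n \<omega>\<bar> \<le> \<epsilon> / 4 * harm n" using not \<omega> unfolding E3_def by force
        define v where "v = (\<lambda>i\<in>{1..n}. V (Z i \<omega>))"
        have ord: "orders n v (\<sigma> n \<omega>)"
          using assms(7) unfolding ordering_rule_def \<sigma>_def v_def by (auto simp: space_PiM)
        have perm: "\<sigma> n \<omega> permutes {1..n}" using ord by (simp add: orders_def)
        \<comment> \<open>The error made when the conditional probability at a point is replaced by
          its value at the top canonical score.\<close>
        define e where "e i = g (F (V (Z i \<omega>))) - ybar 1" for i
        have m_eq: "m = card {i \<in> {1..n}. 1 - \<delta> < F (v i)}"
          unfolding m_def by (intro arg_cong[where f = card]) (use Z \<omega> in \<open>auto simp: A1_def v_def\<close>)
        have "\<bar>\<Sum>r=1..n. e (\<sigma> n \<omega> r) * inverse (real r)\<bar> \<le> \<epsilon> / 4 * harm n + 2 * C * (harm n - harm m)"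
          unfolding m_eq
        proof (rule orders_weighted_sum_le[OF ord])
          show "\<bar>e i\<bar> \<le> 2 * C" for i using C[OF F01, of "V (Z i \<omega>)"] C[of 1] by (simp add: e_def g)
          show "\<bar>e i\<bar> \<le> \<epsilon> / 4" if "i \<in> {1..n}" "1 - \<delta> < F (v i)" for i
            using near[OF F01] that by (simp add: e_def g v_def)
          show "1 - \<delta> < F t" if "1 - \<delta> < F s" "s \<le> t" for s t using mono[OF that(2)] that(1) by linarith
        qed (use \<epsilon> in simp)
        also have "2 * C * (harm n - harm m) \<le> C\<^sub>1"
          unfolding C\<^sub>1_def using C0 q1 n m by (intro mult_left_mono harm_diff_le) auto
        finally have e: "\<bar>\<Sum>r=1..n. e (\<sigma> n \<omega> r) * inverse (real r)\<bar> \<le> \<epsilon> / 4 * harm n + C\<^sub>1" by simp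
        define D where "D = DCG \<rho> (\<lambda>r. inverse (real r)) f n (\<lambda>i. Z i \<omega>)"
        define I where "I = IDCG (\<lambda>r. inverse (real r)) n (\<lambda>i. Z i \<omega>)"
        have "D = (\<Sum>r=1..n. snd (Z (\<sigma> n \<omega> r) \<omega>) * inverse (real r))"
          unfolding D_def DCG_def DCG_perm_def \<sigma>_def V_def ..
        \<comment> \<open>Each label splits into noise, the error \<open>e\<close>, and the constant
          \<open>ybar 1\<close>, which contributes the main term
          \<open>ybar 1 * harm n\<close>.\<close>
        also have "\<dots> = (\<Sum>r=1..n. W (Z (\<sigma> n \<omega> r) \<omega>) * inverse (real r)
            + e (\<sigma> n \<omega> r) * inverse (real r) + ybar 1 * inverse (real r))"
          by (intro sum.cong) (simp_all add: W_def e_def algebra_simps)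
        also have "\<dots> = T n \<omega> + (\<Sum>r=1..n. e (\<sigma> n \<omega> r) * inverse (real r)) + ybar 1 * harm n"
          by (simp add: sum.distrib T_def harm_def sum_distrib_left)
        finally have "D - ybar 1 * harm n = T n \<omega> + (\<Sum>r=1..n. e (\<sigma> n \<omega> r) * inverse (real r))"
          by simp
        then have "\<bar>D - ybar 1 * harm n\<bar> \<le> \<epsilon> / 4 * harm n + (\<epsilon> / 4 * harm n + C\<^sub>1)"
          using abs_triangle_ineq add_mono[OF T e] by (metis order_trans)
        then have D: "\<bar>D - ybar 1 * harm n\<bar> \<le> \<epsilon> / 2 * harm n + C\<^sub>1"
          by (simp add: field_simps)
        have bin: "snd (Z i \<omega>) \<in> {0, 1}" if "i \<in> {1..n}" for i
          using Z[of i \<omega>] \<omega> that by (auto simp: spP)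
        have K_eq: "K = card {i \<in> {1..n}. snd (Z i \<omega>) = 1}"
          unfolding K_def by (intro arg_cong[where f = card]) (use Z \<omega> in \<open>auto simp: A2_def\<close>)
        have "harm K \<le> I" "I \<le> harm n"
          unfolding K_eq I_def by (rule IDCG_binary_bounds[where S = "\<lambda>i. Z i \<omega>", OF bin], assumption)+
        moreover have "harm n - harm K \<le> C\<^sub>2"
          unfolding C\<^sub>2_def using q2 n K by (intro harm_diff_le) auto
        ultimately have "\<bar>D / I - ybar 1\<bar> \<le> \<epsilon>"
          using n by (intro abs_ratio_diff_le[OF D _ _ \<epsilon>, where C\<^sub>2 = C\<^sub>2]) (auto simp: N0_def)
        then show False using bad by (simp add: bad_def NDCG_def D_def I_def)
      qed
    qed
    have harm: "filterlim (harm :: nat \<Rightarrow> real) at_top sequentially" by (rule harm_at_top)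
    let ?b = "\<lambda>n. 4 / q1\<^sup>2 * inverse (real n) + 4 / q2\<^sup>2 * inverse (real n) + (1 + C)\<^sup>2 / (\<epsilon> / 4)\<^sup>2 * inverse (harm n)"
    have upper: "eventually (\<lambda>n. M.prob (bad n) \<le> ?b n) sequentially"
      using eventually_gt_at_top[of 0] harm[unfolded filterlim_at_top, rule_format, of N0]
    proof eventually_elim
      case (elim n)
      have ev: "E A1 q1 n \<in> M.events" "E A2 q2 n \<in> M.events" "E3 n \<in> M.events"
        using E12(1)[OF A(1) q1_def q1 elim(1)] E12(1)[OF A(2) q2_def q2 elim(1)] E3(1)[OF elim(1)] .
      \<comment> \<open>Monotonicity asks only the covering union to be an event; a set outside the
        \<sigma>-algebra has measure 0 by convention.\<close>
      have "M.prob (bad n) \<le> M.prob (E A1 q1 n \<union> E A2 q2 n \<union> E3 n)"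
        by (rule M.finite_measure_mono[OF sub[OF elim]]) (use ev in auto)
      also have "\<dots> \<le> M.prob (E A1 q1 n) + M.prob (E A2 q2 n) + M.prob (E3 n)"
        by (intro order_trans[OF measure_Un_le] add_mono order_refl sets.Un ev)
      also have "\<dots> \<le> ?b n"
        by (intro add_mono E12(2)[OF A(1) q1_def q1 elim(1)] E12(2)[OF A(2) q2_def q2 elim(1)] E3(2)[OF elim(1)])
      finally show ?case .
    qed
    \<comment> \<open>All three terms vanish in the limit, the last one only because the harmonic
      series diverges.\<close>
    have "?b \<longlonglongrightarrow> 4 / q1\<^sup>2 * 0 + 4 / q2\<^sup>2 * 0 + (1 + C)\<^sup>2 / (\<epsilon> / 4)\<^sup>2 * 0"
      by (intro tendsto_intros tendsto_inverse_0_at_top harm filterlim_real_sequentially)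
    then have lim: "?b \<longlonglongrightarrow> 0" by (simp only: mult_zero_right add_0_left)
    have "(\<lambda>n. M.prob (bad n)) \<longlonglongrightarrow> 0"
      by (rule tendsto_sandwich[OF _ upper tendsto_const lim]) simp
    then show "(\<lambda>n. M.prob {\<omega> \<in> space M. \<bar>NDCG \<rho> (\<lambda>r. inverse (real r)) f n (\<lambda>i. Z i \<omega>) - ybar 1\<bar> > \<epsilon>}) \<longlonglongrightarrow> 0"
      unfolding bad_def .
  qed
qed

end
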